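(* Let $p\ge1$. Suppose that $u\in F^1_{USCG}(X)$ and $u_n\in F^1_{USC}(X)$, $n=1,2,\ldots$, and that there is a measurable function $F:[0,1]\to\mathbb R\cup\{+\infty\}$ such that $\int_0^1F^p(\alpha)\,d\alpha<+\infty$ and $H([u_n]_\alpha,[u]_\alpha)\le F(\alpha)$ for all $\alpha\in[0,1]$ and $n=1,2,\ldots$. If $H_{\rm end}(u_n,u)\to0$, then $d_p(u_n,u)\to0$.
   Context: $(X,d)$ is a nonempty metric space. $X\times[0,1]$ carries the metric $\overline d((x,\alpha),(y,\beta))=d(x,y)+|\alpha-\beta|$. A fuzzy set in $X$ is a function $u:X\to[0,1]$, with $\alpha$-cuts $[u]_\alpha=\{x\in X: u(x)\ge\alpha\}$ for $\alpha\in(0,1]$ and $[u]_0=\overline{\{x\in X:u(x)>0\}}$ (closure in $X$). $F^1_{USC}(X)$ is the set of fuzzy sets $u$ in $X$ such that $[u]_\alpha$ is nonempty and closed for all $\alpha\in[0,1]$; $F^1_{USCG}(X)$ is the set of $u\in F^1_{USC}(X)$ with $[u]_\alpha$ compact for all $\alpha\in(0,1]$. For nonempty closed sets $A,B$, $H(A,B)=\max\{\sup_{a\in A}\inf_{b\in B}\rho(a,b),\sup_{b\in B}\inf_{a\in A}\rho(a,b)\}\in[0,+\infty]$ is the Hausdorff distance, with $\rho=d$ on $X$ and $\rho=\overline d$ on $X\times[0,1]$. With ${\rm end}\,u=\{(x,t)\in X\times[0,1]:u(x)\ge t\}$, $H_{\rm end}(u,v)=H({\rm end}\,u,{\rm end}\,v)$.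 For $p\ge1$, $d_p(u,v)=(\int_0^1H([u]_\alpha,[v]_\alpha)^p\,d\alpha)^{1/p}$ (Lebesgue measure). It is a known fact that $\alpha\mapsto H([u]_\alpha,[v]_\alpha)$ is measurable on $[0,1]$ (with values in $\mathbb R\cup\{+\infty\}$) whenever $u\in F^1_{USCG}(X)$ and $v\in F^1_{USC}(X)$, so $d_p(u_n,u)$ is well-defined here. *)

theory Defs
  imports "HOL-Analysis.Analysis"
begin

definition hausdorff_distance :: "('b \<Rightarrow> 'b \<Rightarrow> real) \<Rightarrow> 'b set \<Rightarrow> 'b set \<Rightarrow> ennreal" where
  "hausdorff_distance \<rho> A B =
     max (SUP a\<in>A. INF b\<in>B. ennreal (\<rho> a b)) (SUP b\<in>B. INF a\<in>A. ennreal (\<rho> a b))"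

(* The library metric on 'a * real is the Euclidean combination, so the sum metric is
   introduced separately. It is only used on points with second coordinate in [0,1]. *)
definition sum_metric :: "('a::metric_space) \<times> real \<Rightarrow> 'a \<times> real \<Rightarrow> real" where
  "sum_metric = (\<lambda>(x, \<alpha>) (y, \<beta>). dist x y + \<bar>\<alpha> - \<beta>\<bar>)"

definition fuzzy_set :: "('a \<Rightarrow> real) \<Rightarrow> bool" where
  "fuzzy_set u \<longleftrightarrow> (\<forall>x. u x \<in> {0..1})"

definition alpha_cut :: "('a::topological_space \<Rightarrow> real) \<Rightarrow> real \<Rightarrow> 'a set" where
  "alpha_cut u \<alpha> = (if \<alpha> = 0 then closure {x. u x > 0} else {x. u x \<ge> \<alpha>})"

definition F1_USC :: "('a::metric_space \<Rightarrow> real) set" where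
  "F1_USC = {u. fuzzy_set u \<and> (\<forall>\<alpha>\<in>{0..1}. alpha_cut u \<alpha> \<noteq> {} \<and> closed (alpha_cut u \<alpha>))}"

definition F1_USCG :: "('a::metric_space \<Rightarrow> real) set" where
  "F1_USCG = {u \<in> F1_USC. \<forall>\<alpha>\<in>{0<..1}. compact (alpha_cut u \<alpha>)}"

definition endograph :: "('a \<Rightarrow> real) \<Rightarrow> ('a \<times> real) set" where
  "endograph u = {(x, t). t \<in> {0..1} \<and> u x \<ge> t}"

definition H_end :: "('a::metric_space \<Rightarrow> real) \<Rightarrow> ('a \<Rightarrow> real) \<Rightarrow> ennreal" where
  "H_end u v = hausdorff_distance sum_metric (endograph u) (endograph v)"

(* Real powers on [0,\<infinity>]; the value at \<infinity> is the intended one for positive exponents only. *)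
definition ennreal_powr :: "ennreal \<Rightarrow> real \<Rightarrow> ennreal" where
  "ennreal_powr x p = (if x = \<infinity> then \<infinity> else ennreal (enn2real x powr p))"

(* For u in F1_USC and v in F1_USCG the integrand is measurable (a known fact), so there the
   nonnegative integral is the ordinary Lebesgue integral. *)
definition d_p :: "real \<Rightarrow> ('a::metric_space \<Rightarrow> real) \<Rightarrow> ('a \<Rightarrow> real) \<Rightarrow> ennreal" where
  "d_p p u v = ennreal_powr
     (\<integral>\<^sup>+ \<alpha>. ennreal_powr (hausdorff_distance dist (alpha_cut u \<alpha>) (alpha_cut v \<alpha>)) p \<partial>lebesgue_on {0..1})
     (1 / p)"

end

theory Submission
  imports Defs
begin

text \<open>
  Convergence of endographs controls every cut up to a small change of level: if
  \<open>H_end v u < \<epsilon>\<close>, then the \<open>\<alpha>\<close>-cut of \<open>v\<close> lies within \<open>\<epsilon>\<close> of the cut of \<open>u\<close> at level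
  \<open>\<alpha> - \<epsilon>\<close>, and the cut of \<open>u\<close> at level \<open>\<alpha> + \<epsilon>\<close> lies within \<open>\<epsilon>\<close> of the \<open>\<alpha>\<close>-cut of \<open>v\<close>,
  as long as these levels lie in \<open>(0, 1]\<close>.  So the
  \<open>\<alpha>\<close>-cuts converge in the Hausdorff distance at each level \<open>\<alpha>\<close> at which the cuts of the limit
  \<open>u\<close> depend continuously on the level.

  Continuity from below holds at every positive level, because the compact cuts at lower
  levels decrease to the \<open>\<alpha>\<close>-cut (\<open>compact_cuts_left_continuous\<close>).  Continuity from above holds
  at \<open>\<alpha>\<close> unless some point of the \<open>\<alpha>\<close>-cut has positive distance to \<open>{x. \<alpha> < u x}\<close>; by
  total boundedness of the cuts there are only countably many such levels
  (\<open>countable_platform_levels\<close>).  Hence the Hausdorff distances of the cuts tend to \<open>0\<close> at almost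
  every level, and since their \<open>p\<close>-th powers have the integrable majorant \<open>F\<^sup>p\<close>, dominated
  convergence gives the claim.

  The integral \<open>nn_integral\<close> of an arbitrary function is the supremum of the integrals of the
  simple functions below it.  Dominated convergence to \<open>0\<close> passes from those simple functions to
  arbitrary integrands, and it is applied in that form (\<open>nn_integral_tendsto_0_dominated\<close>).
\<close>

section \<open>Real powers of extended nonnegative reals\<close>

lemma ennreal_powr_mono:
  assumes "x \<le> y" "0 \<le> p"
  shows "ennreal_powr x p \<le> ennreal_powr y p"
  using assms
  by (cases x; cases y) (auto simp: ennreal_powr_def top_unique intro!: ennreal_leI powr_mono2)

lemma measurable_ennreal_powr [measurable]:
  "(\<lambda>x. ennreal_powr x p) \<in> borel_measurable borel"
  unfolding ennreal_powr_def by measurable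

lemma tendsto_ennreal_powr_0:
  assumes "(f \<longlongrightarrow> 0) \<F>" "0 < p"
  shows "((\<lambda>x. ennreal_powr (f x) p) \<longlongrightarrow> 0) \<F>"
proof -
  have fin: "\<forall>\<^sub>F x in \<F>. f x < \<infinity>"
    using assms(1) by (rule order_tendstoD) simp
  have "((\<lambda>x. enn2real (f x)) \<longlongrightarrow> enn2real 0) \<F>"
    using assms(1) by (intro tendsto_enn2real) auto
  then have "((\<lambda>x. enn2real (f x) powr p) \<longlongrightarrow> 0 powr p) \<F>"
    using assms(2) by (intro tendsto_powr') auto
  then have "((\<lambda>x. ennreal (enn2real (f x) powr p)) \<longlongrightarrow> ennreal (0 powr p)) \<F>"
    by (rule tendsto_ennrealI)
  moreover have "\<forall>\<^sub>F x in \<F>. ennreal (enn2real (f x) powr p) = ennreal_powr (f x) p"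
    using fin by eventually_elim (auto simp: ennreal_powr_def)
  ultimately show ?thesis
    by (simp add: tendsto_cong)
qed

section \<open>Dominated convergence for the lower integral\<close>

text \<open>
  A lower integral above \<open>c\<close> is witnessed by a simple function below the integrand whose integral
  is above \<open>c\<close>.  These witnesses inherit the majorant and the convergence to \<open>0\<close>, so the
  ordinary dominated convergence theorem applies to them.
\<close>

lemma nn_integral_tendsto_0_dominated:
  fixes f :: "nat \<Rightarrow> 'a \<Rightarrow> ennreal"
  assumes w: "w \<in> borel_measurable M" "(\<integral>\<^sup>+ x. w x \<partial>M) < \<infinity>"
    and le: "\<And>n. AE x in M. f n x \<le> w x"
    and lim: "AE x in M. (\<lambda>n. f n x) \<longlonglongrightarrow> 0"
  shows "(\<lambda>n. \<integral>\<^sup>+ x. f n x \<partial>M) \<longlonglongrightarrow> 0"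
proof (rule order_tendstoI)
  fix a :: ennreal
  assume "0 < a"
  then obtain c where c: "0 < c" "c < a"
    using dense by blast
  have "\<exists>g. simple_function M g \<and> g \<le> f n \<and>
          (c < (\<integral>\<^sup>+ x. f n x \<partial>M) \<longrightarrow> c < (\<integral>\<^sup>+ x. g x \<partial>M))" for n
  proof (cases "c < (\<integral>\<^sup>+ x. f n x \<partial>M)")
    case True
    then obtain g where "simple_function M g" "g \<le> f n" "c < integral\<^sup>S M g"
      unfolding nn_integral_def less_SUP_iff by auto
    then show ?thesis
      by (metis nn_integral_eq_simple_integral)
  next
    case False
    then show ?thesis
      by (intro exI[of _ "\<lambda>_. 0"]) (auto simp: le_fun_def)
  qed
  then obtain g where g: "\<And>n. simple_function M (g n)" "\<And>n. g n \<le> f n"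
      "\<And>n. c < (\<integral>\<^sup>+ x. f n x \<partial>M) \<Longrightarrow> c < (\<integral>\<^sup>+ x. g n x \<partial>M)"
    by metis
  have "(\<lambda>n. \<integral>\<^sup>+ x. g n x \<partial>M) \<longlonglongrightarrow> (\<integral>\<^sup>+ x. 0 \<partial>M)"
  proof (rule nn_integral_dominated_convergence[where w = w])
    show "AE x in M. g n x \<le> w x" for n
      using le[of n] by eventually_elim (meson g(2) le_funD order_trans)
    show "AE x in M. (\<lambda>n. g n x) \<longlonglongrightarrow> 0"
      using lim
    proof eventually_elim
      case (elim x)
      show ?case
        using g(2) by (intro tendsto_sandwich[OF _ _ tendsto_const elim]) (auto simp: le_fun_def)
    qed
  qed (use w g(1) in \<open>auto intro: borel_measurable_simple_function\<close>)
  then have "\<forall>\<^sub>F n in sequentially. (\<integral>\<^sup>+ x. g n x \<partial>M) < c"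
    using c(1) by (auto dest: order_tendstoD(2))
  then show "\<forall>\<^sub>F n in sequentially. (\<integral>\<^sup>+ x. f n x \<partial>M) < a"
    by eventually_elim (meson c(2) g(3) le_less_trans not_le order_less_asym)
qed auto

section \<open>Hausdorff distance\<close>

lemma hausdorff_distance_lessD:
  assumes "hausdorff_distance \<rho> A B < ennreal e"
  shows "a \<in> A \<Longrightarrow> \<exists>b\<in>B. \<rho> a b < e" and "b \<in> B \<Longrightarrow> \<exists>a\<in>A. \<rho> a b < e"
proof -
  have less: "r < e" if "ennreal r < ennreal e" for r
    using that by (meson ennreal_leI not_le)
  have AB: "(SUP a\<in>A. INF b\<in>B. ennreal (\<rho> a b)) < ennreal e"
    and BA: "(SUP b\<in>B. INF a\<in>A. ennreal (\<rho> a b)) < ennreal e"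
    using assms by (auto simp: hausdorff_distance_def)
  show "\<exists>b\<in>B. \<rho> a b < e" if "a \<in> A"
    using le_less_trans[OF SUP_upper[OF that] AB] less by (auto simp: INF_less_iff)
  show "\<exists>a\<in>A. \<rho> a b < e" if "b \<in> B"
    using le_less_trans[OF SUP_upper[OF that] BA] less by (auto simp: INF_less_iff)
qed

lemma hausdorff_distance_leI:
  assumes "\<And>a. a \<in> A \<Longrightarrow> \<exists>b\<in>B. \<rho> a b \<le> e" and "\<And>b. b \<in> B \<Longrightarrow> \<exists>a\<in>A. \<rho> a b \<le> e"
  shows "hausdorff_distance \<rho> A B \<le> ennreal e"
  unfolding hausdorff_distance_def
proof (intro max.boundedI SUP_least)
  show "(INF b\<in>B. ennreal (\<rho> a b)) \<le> ennreal e" if "a \<in> A" for a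
    using assms(1)[OF that] by (meson INF_lower2 ennreal_leI)
  show "(INF a\<in>A. ennreal (\<rho> a b)) \<le> ennreal e" if "b \<in> B" for b
    using assms(2)[OF that] by (meson INF_lower2 ennreal_leI)
qed

section \<open>Dependence of compact cuts on the level\<close>

text \<open>
  The part of a lower cut that stays outside the \<open>\<delta>\<close>-neighbourhood of the \<open>\<alpha>\<close>-cut is compact, and
  \<open>u < \<alpha>\<close> on it; so it is covered by the open sets \<open>{x. u x < \<beta>}\<close> with \<open>\<beta> < \<alpha>\<close>, hence by one
  of them.
\<close>

lemma compact_cuts_left_continuous:
  fixes u :: "'a::metric_space \<Rightarrow> real"
  assumes cpt: "\<And>\<alpha>. 0 < \<alpha> \<Longrightarrow> compact {x. \<alpha> \<le> u x}" and "0 < \<alpha>" "0 < \<delta>"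
  shows "\<exists>\<beta>>0. \<beta> < \<alpha> \<and> (\<forall>x. \<beta> \<le> u x \<longrightarrow> (\<exists>y. \<alpha> \<le> u y \<and> dist x y < \<delta>))"
proof -
  define K where "K = {x. \<alpha> / 2 \<le> u x} - (\<Union>y\<in>{y. \<alpha> \<le> u y}. ball y \<delta>)"
  have "compact K"
    unfolding K_def using \<open>0 < \<alpha>\<close> by (intro compact_diff cpt) auto
  moreover have "open (- {x. \<beta> \<le> u x})" if "\<beta> \<in> {\<alpha> / 2..<\<alpha>}" for \<beta>
    using cpt[of \<beta>] that \<open>0 < \<alpha>\<close> by (auto intro: compact_imp_closed)
  moreover have "K \<subseteq> (\<Union>\<beta>\<in>{\<alpha> / 2..<\<alpha>}. - {x. \<beta> \<le> u x})"
  proof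
    fix x assume x: "x \<in> K"
    have "\<alpha> / 2 \<le> u x" "u x < \<alpha>"
      using x \<open>0 < \<delta>\<close> unfolding K_def by (auto simp: not_le[symmetric])
    then have "(u x + \<alpha>) / 2 \<in> {\<alpha> / 2..<\<alpha>}" "\<not> (u x + \<alpha>) / 2 \<le> u x"
      using \<open>0 < \<alpha>\<close> by auto
    then show "x \<in> (\<Union>\<beta>\<in>{\<alpha> / 2..<\<alpha>}. - {x. \<beta> \<le> u x})"
      by blast
  qed
  ultimately obtain L where L: "L \<subseteq> {\<alpha> / 2..<\<alpha>}" "finite L" "K \<subseteq> (\<Union>\<beta>\<in>L. - {x. \<beta> \<le> u x})"
    by (rule compactE_image)
  \<comment> \<open>Inserting \<open>\<alpha> / 2\<close> covers the case that \<open>L\<close> is empty and keeps the level within the cut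
      that \<open>K\<close> was taken from.\<close>
  define \<beta> where "\<beta> = Max (insert (\<alpha> / 2) L)"
  have ge: "\<gamma> \<le> \<beta>" if "\<gamma> \<in> insert (\<alpha> / 2) L" for \<gamma>
    using that L(2) unfolding \<beta>_def by (intro Max_ge) auto
  have "\<beta> \<in> insert (\<alpha> / 2) L"
    unfolding \<beta>_def using L(2) by (intro Max_in) auto
  then have "0 < \<beta>" "\<beta> < \<alpha>"
    using L(1) \<open>0 < \<alpha>\<close> by auto
  moreover have "\<exists>y. \<alpha> \<le> u y \<and> dist x y < \<delta>" if "\<beta> \<le> u x" for x
  proof -
    have "x \<notin> K"
      using L(3) ge that by force
    moreover have "\<alpha> / 2 \<le> u x"
      using ge[of "\<alpha> / 2"] that by auto
    ultimately show ?thesis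
      unfolding K_def by (auto simp: dist_commute)
  qed
  ultimately show ?thesis
    by blast
qed

text \<open>
  Finitely many \<open>\<delta>\<close>-balls around points of \<open>{y. \<alpha> < u y}\<close> cover the \<open>\<alpha>\<close>-cut; \<open>\<beta>\<close> is the smallest
  value of \<open>u\<close> at their centres.
\<close>

lemma compact_cuts_right_continuous:
  fixes u :: "'a::metric_space \<Rightarrow> real"
  assumes "compact {x. \<alpha> \<le> u x}" "{x. \<alpha> \<le> u x} \<noteq> {}"
    and dense: "{x. \<alpha> \<le> u x} \<subseteq> closure {x. \<alpha> < u x}" and "0 < \<delta>"
  shows "\<exists>\<beta>\<in>range u. \<alpha> < \<beta> \<and> (\<forall>x. \<alpha> \<le> u x \<longrightarrow> (\<exists>y. \<beta> \<le> u y \<and> dist x y < \<delta>))"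
proof -
  have "{x. \<alpha> \<le> u x} \<subseteq> (\<Union>y\<in>{x. \<alpha> < u x}. ball y \<delta>)"
    using dense \<open>0 < \<delta>\<close> by (fastforce simp: closure_approachable)
  then obtain Y where Y: "Y \<subseteq> {x. \<alpha> < u x}" "finite Y" "{x. \<alpha> \<le> u x} \<subseteq> (\<Union>y\<in>Y. ball y \<delta>)"
    using compactE_image[OF assms(1), of "{x. \<alpha> < u x}" "\<lambda>y. ball y \<delta>"] by auto
  have "Y \<noteq> {}"
    using Y(3) assms(2) by auto
  then have "Min (u ` Y) \<in> u ` Y"
    using Y(2) by (intro Min_in) auto
  moreover have "\<exists>y. Min (u ` Y) \<le> u y \<and> dist x y < \<delta>" if "\<alpha> \<le> u x" for x
  proof -
    have "x \<in> (\<Union>y\<in>Y. ball y \<delta>)"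
      using Y(3) that by blast
    then obtain y where "y \<in> Y" "dist x y < \<delta>"
      by (auto simp: dist_commute)
    then show ?thesis
      using Y(2) by (auto intro!: exI[of _ y] Min_le)
  qed
  ultimately show ?thesis
    using Y(1) by (intro bexI[of _ "Min (u ` Y)"]) auto
qed

text \<open>
  Call a point \<open>\<delta>\<close>-isolated from above if every point with a larger value of \<open>u\<close> has distance at
  least \<open>\<delta>\<close> from it.  An exceptional level is the value of \<open>u\<close> at such a point, for some
  \<open>\<delta> = 1 / (k + 1)\<close>.  On a ball of radius \<open>\<delta> / 2\<close> the function \<open>u\<close> takes at most one value at such
  points, because two different values would put the points at distance at least \<open>\<delta>\<close>.  Finitely
  many such balls cover a compact cut, so only finitely many exceptional levels for \<open>\<delta>\<close> exceed
  a given positive level.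
\<close>

lemma countable_platform_levels:
  fixes u :: "'a::metric_space \<Rightarrow> real"
  assumes cpt: "\<And>\<alpha>. 0 < \<alpha> \<Longrightarrow> compact {x. \<alpha> \<le> u x}"
  shows "countable {\<alpha>. 0 < \<alpha> \<and> \<not> {x. \<alpha> \<le> u x} \<subseteq> closure {x. \<alpha> < u x}}"
proof -
  define I where "I \<delta> = {x. \<forall>y. u x < u y \<longrightarrow> \<delta> \<le> dist y x}" for \<delta>
  have fin: "finite (u ` (I \<delta> \<inter> {x. a \<le> u x}))" if "0 < \<delta>" "0 < a" for \<delta> a
  proof -
    have "{x. a \<le> u x} \<subseteq> (\<Union>c\<in>UNIV. ball c (\<delta> / 2))"
      using \<open>0 < \<delta>\<close> by (meson UNIV_I UN_I centre_in_ball half_gt_zero subsetI)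
    then obtain T where T: "finite T" "{x. a \<le> u x} \<subseteq> (\<Union>c\<in>T. ball c (\<delta> / 2))"
      using compactE_image[OF cpt[OF \<open>0 < a\<close>], of UNIV "\<lambda>c. ball c (\<delta> / 2)"] by auto
    have const: "u x = u y" if "x \<in> I \<delta> \<inter> ball c (\<delta> / 2)" "y \<in> I \<delta> \<inter> ball c (\<delta> / 2)" for x y c
    proof -
      have "dist x y < \<delta>"
        using that by (auto intro: dist_triangle_half_r)
      moreover have "u x < u y \<Longrightarrow> \<delta> \<le> dist y x" "u y < u x \<Longrightarrow> \<delta> \<le> dist x y"
        using that unfolding I_def by blast+
      ultimately show ?thesis
        by (cases "u x" "u y" rule: linorder_cases) (auto simp: dist_commute)
    qed
    have single: "u ` (I \<delta> \<inter> ball c (\<delta> / 2)) \<subseteq> {u x}" if "x \<in> I \<delta> \<inter> ball c (\<delta> / 2)" for x c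
      by (rule image_subsetI, unfold singleton_iff, rule const[OF _ that])
    have "finite (u ` (I \<delta> \<inter> ball c (\<delta> / 2)))" for c
    proof (cases "I \<delta> \<inter> ball c (\<delta> / 2) = {}")
      case False
      then obtain x where "x \<in> I \<delta> \<inter> ball c (\<delta> / 2)"
        by blast
      from single[OF this] show ?thesis
        by (rule finite_subset) simp
    qed simp
    moreover have "u ` (I \<delta> \<inter> {x. a \<le> u x}) \<subseteq> (\<Union>c\<in>T. u ` (I \<delta> \<inter> ball c (\<delta> / 2)))"
      using T(2) by blast
    ultimately show ?thesis
      using T(1) by (meson finite_UN_I finite_subset)
  qed
  have "{\<alpha>. 0 < \<alpha> \<and> \<not> {x. \<alpha> \<le> u x} \<subseteq> closure {x. \<alpha> < u x}}
      \<subseteq> (\<Union>(k, m). u ` (I (1 / real (Suc k)) \<inter> {x. 1 / real (Suc m) \<le> u x}))"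
  proof
    fix \<alpha> assume "\<alpha> \<in> {\<alpha>. 0 < \<alpha> \<and> \<not> {x. \<alpha> \<le> u x} \<subseteq> closure {x. \<alpha> < u x}}"
    then obtain x where "0 < \<alpha>" and x: "\<alpha> \<le> u x" "x \<notin> closure {x. \<alpha> < u x}"
      by auto
    have "\<not> \<alpha> < u x"
      using x(2) closure_subset[of "{x. \<alpha> < u x}"] by blast
    then have ux: "u x = \<alpha>"
      using x(1) by simp
    obtain e where e: "0 < e" "\<And>y. \<alpha> < u y \<Longrightarrow> e \<le> dist y x"
      using x(2) unfolding closure_approachable by (auto simp flip: not_less)
    obtain k where "1 / real (Suc k) < e"
      using nat_approx_posE[OF \<open>0 < e\<close>] .
    obtain m where "1 / real (Suc m) < \<alpha>"
      using nat_approx_posE[OF \<open>0 < \<alpha>\<close>] .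
    show "\<alpha> \<in> (\<Union>(k, m). u ` (I (1 / real (Suc k)) \<inter> {x. 1 / real (Suc m) \<le> u x}))"
    proof (intro UN_I[of "(k, m)"], simp_all only: prod.case UNIV_I)
      have "x \<in> I (1 / real (Suc k))"
        unfolding I_def using e(2) ux \<open>1 / real (Suc k) < e\<close> by fastforce
      moreover have "1 / real (Suc m) \<le> u x"
        using ux \<open>1 / real (Suc m) < \<alpha>\<close> by simp
      ultimately show "\<alpha> \<in> u ` (I (1 / real (Suc k)) \<inter> {x. 1 / real (Suc m) \<le> u x})"
        using ux by blast
    qed
  qed
  moreover have "countable (\<Union>(k, m). u ` (I (1 / real (Suc k)) \<inter> {x. 1 / real (Suc m) \<le> u x}))"
    using fin by (intro countable_UN) (auto intro!: countable_finite)
  ultimately show ?thesis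
    by (rule countable_subset)
qed

section \<open>From endographs to cuts\<close>

text \<open>
  Between the levels \<open>\<beta>\<^sub>1 < \<alpha> < \<beta>\<^sub>2\<close> the cuts of \<open>u\<close> stay within \<open>\<delta> / 2\<close> of the \<open>\<alpha>\<close>-cut.  If the endographs are
  closer than the gaps \<open>\<alpha> - \<beta>\<^sub>1\<close> and \<open>\<beta>\<^sub>2 - \<alpha>\<close>, matching points of the endographs have levels on
  the right side of \<open>\<beta>\<^sub>1\<close> and \<open>\<alpha>\<close>, respectively.
\<close>

lemma cuts_tendsto_if_endographs_tendsto:
  fixes u :: "'a::metric_space \<Rightarrow> real"
  assumes cpt: "\<And>\<alpha>. 0 < \<alpha> \<Longrightarrow> compact {x. \<alpha> \<le> u x}"
    and le1: "\<And>x. u x \<le> 1"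
    and \<alpha>: "0 < \<alpha>" "\<alpha> \<le> 1" "{x. \<alpha> \<le> u x} \<noteq> {}" "{x. \<alpha> \<le> u x} \<subseteq> closure {x. \<alpha> < u x}"
    and lim: "((\<lambda>n. H_end (v n) u) \<longlongrightarrow> 0) \<F>"
  shows "((\<lambda>n. hausdorff_distance dist (alpha_cut (v n) \<alpha>) (alpha_cut u \<alpha>)) \<longlongrightarrow> 0) \<F>"
proof (rule order_tendstoI)
  fix a :: ennreal
  assume "0 < a"
  then obtain c where "0 < c" "c < a"
    using dense by blast
  then obtain \<delta> where \<delta>: "0 < \<delta>" "ennreal \<delta> < a"
    by (cases c) auto
  obtain \<beta>\<^sub>1 where \<beta>\<^sub>1: "\<beta>\<^sub>1 < \<alpha>" "\<And>x. \<beta>\<^sub>1 \<le> u x \<Longrightarrow> \<exists>y. \<alpha> \<le> u y \<and> dist x y < \<delta> / 2"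
    using compact_cuts_left_continuous[OF cpt \<open>0 < \<alpha>\<close>, of "\<delta> / 2"] \<delta>(1) by auto
  obtain \<beta>\<^sub>2 where \<beta>\<^sub>2: "\<alpha> < \<beta>\<^sub>2" "\<beta>\<^sub>2 \<le> 1" "\<And>x. \<alpha> \<le> u x \<Longrightarrow> \<exists>y. \<beta>\<^sub>2 \<le> u y \<and> dist x y < \<delta> / 2"
    using compact_cuts_right_continuous[OF cpt[OF \<alpha>(1)] \<alpha>(3,4), of "\<delta> / 2"] \<delta>(1) le1 by auto
  define \<epsilon> where "\<epsilon> = min (\<delta> / 2) (min (\<alpha> - \<beta>\<^sub>1) (\<beta>\<^sub>2 - \<alpha>))"
  have \<epsilon>: "0 < \<epsilon>" "\<epsilon> \<le> \<delta> / 2" "\<beta>\<^sub>1 \<le> \<alpha> - \<epsilon>" "\<alpha> \<le> \<beta>\<^sub>2 - \<epsilon>"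
    using \<delta>(1) \<beta>\<^sub>1(1) \<beta>\<^sub>2(1) unfolding \<epsilon>_def by linarith+
  have "\<forall>\<^sub>F n in \<F>. H_end (v n) u < ennreal \<epsilon>"
    using lim \<epsilon>(1) by (auto intro: order_tendstoD(2))
  then show "\<forall>\<^sub>F n in \<F>. hausdorff_distance dist (alpha_cut (v n) \<alpha>) (alpha_cut u \<alpha>) < a"
  proof eventually_elim
    case (elim n)
    note match = hausdorff_distance_lessD[OF elim[unfolded H_end_def]]
    have "\<exists>y. \<alpha> \<le> u y \<and> dist x y \<le> \<delta>" if "\<alpha> \<le> v n x" for x
    proof -
      have "(x, \<alpha>) \<in> endograph (v n)"
        using that \<alpha> by (auto simp: endograph_def)
      from match(1)[OF this] obtain y t where y: "t \<le> u y" "dist x y + \<bar>\<alpha> - t\<bar> < \<epsilon>"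
        by (auto simp: endograph_def sum_metric_def)
      then have "\<beta>\<^sub>1 \<le> u y" "dist x y < \<delta> / 2"
        using \<epsilon> zero_le_dist[of x y] by linarith+
      moreover from \<beta>\<^sub>1(2)[OF this(1)] obtain z where "\<alpha> \<le> u z" "dist y z < \<delta> / 2"
        by auto
      ultimately show ?thesis
        using dist_triangle[of x z y] by (intro exI[of _ z]) linarith
    qed
    moreover have "\<exists>z. \<alpha> \<le> v n z \<and> dist z x \<le> \<delta>" if "\<alpha> \<le> u x" for x
    proof -
      obtain y where y: "\<beta>\<^sub>2 \<le> u y" "dist x y < \<delta> / 2"
        using \<beta>\<^sub>2(3) \<open>\<alpha> \<le> u x\<close> by blast
      then have "(y, \<beta>\<^sub>2) \<in> endograph u"
        using \<beta>\<^sub>2 \<alpha> by (auto simp: endograph_def)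
      from match(2)[OF this] obtain z t where z: "t \<le> v n z" "dist z y + \<bar>t - \<beta>\<^sub>2\<bar> < \<epsilon>"
        by (auto simp: endograph_def sum_metric_def)
      then have "\<alpha> \<le> v n z" "dist z y < \<delta> / 2"
        using \<epsilon> zero_le_dist[of z y] by linarith+
      then show ?thesis
        using y dist_triangle[of z x y] by (intro exI[of _ z]) (auto simp: dist_commute)
    qed
    ultimately have "hausdorff_distance dist (alpha_cut (v n) \<alpha>) (alpha_cut u \<alpha>) \<le> ennreal \<delta>"
      using \<alpha>(1) by (intro hausdorff_distance_leI) (auto simp: alpha_cut_def)
    then show ?case
      using \<delta>(2) by (rule le_less_trans)
  qed
qed auto

section \<open>Convergence in the integral metric\<close>

theorem theorem6p3:
  fixes p :: real
    and u :: "'a::metric_space \<Rightarrow> real"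
    and us :: "nat \<Rightarrow> 'a \<Rightarrow> real"
    and F :: "real \<Rightarrow> ennreal"
  assumes "p \<ge> 1"
    and "u \<in> F1_USCG"
    and "\<And>n. n \<ge> 1 \<Longrightarrow> us n \<in> F1_USC"
    and "F \<in> borel_measurable (lebesgue_on {0..1})"
    and "(\<integral>\<^sup>+ \<alpha>. ennreal_powr (F \<alpha>) p \<partial>lebesgue_on {0..1}) < \<infinity>"
    and "\<And>n \<alpha>. n \<ge> 1 \<Longrightarrow> \<alpha> \<in> {0..1} \<Longrightarrow>
           hausdorff_distance dist (alpha_cut (us n) \<alpha>) (alpha_cut u \<alpha>) \<le> F \<alpha>"
    and "(\<lambda>n. H_end (us n) u) \<longlonglongrightarrow> 0"
  shows "(\<lambda>n. d_p p (us n) u) \<longlonglongrightarrow> 0"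
proof -
  let ?h = "\<lambda>n \<alpha>. ennreal_powr (hausdorff_distance dist (alpha_cut (us n) \<alpha>) (alpha_cut u \<alpha>)) p"
  have p: "0 < p"
    using assms(1) by simp
  have u01: "0 \<le> u x" "u x \<le> 1" for x
    using assms(2) by (auto simp: F1_USCG_def F1_USC_def fuzzy_set_def)
  have cpt: "compact {x. \<alpha> \<le> u x}" if "0 < \<alpha>" for \<alpha>
  proof (cases "\<alpha> \<le> 1")
    case True
    then have "compact (alpha_cut u \<alpha>)"
      using assms(2) that by (auto simp: F1_USCG_def)
    then show ?thesis
      using that by (simp add: alpha_cut_def)
  next
    case False
    then have "{x. \<alpha> \<le> u x} = {}"
      using u01(2) by (auto intro: order_trans)
    then show ?thesis
      by simp
  qed
  have ne: "{x. \<alpha> \<le> u x} \<noteq> {}" if "0 < \<alpha>" "\<alpha> \<le> 1" for \<alpha>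
  proof -
    have "alpha_cut u \<alpha> \<noteq> {}"
      using assms(2) that by (auto simp: F1_USCG_def F1_USC_def)
    then show ?thesis
      using that by (simp add: alpha_cut_def)
  qed
  define P where "P = insert 0 {\<alpha>. 0 < \<alpha> \<and> \<not> {x. \<alpha> \<le> u x} \<subseteq> closure {x. \<alpha> < u x}}"
  have "countable P"
    unfolding P_def by (intro countable_insert countable_platform_levels cpt)
  then have "P \<in> null_sets lebesgue"
    using countable_imp_null_set_lborel null_sets_completionI by blast
  then have "AE \<alpha> in lebesgue. \<alpha> \<notin> P"
    by (rule AE_not_in)
  then have "AE \<alpha> in lebesgue. \<alpha> \<in> {0..1} \<longrightarrow> (\<lambda>n. ?h n \<alpha>) \<longlonglongrightarrow> 0"
  proof eventually_elim
    case (elim \<alpha>)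
    show ?case
    proof
      assume "\<alpha> \<in> {0..1}"
      with elim have "0 < \<alpha>" "\<alpha> \<le> 1" "{x. \<alpha> \<le> u x} \<subseteq> closure {x. \<alpha> < u x}"
        unfolding P_def by auto
      then show "(\<lambda>n. ?h n \<alpha>) \<longlonglongrightarrow> 0"
        using p assms(7) ne u01(2) cpt
        by (intro tendsto_ennreal_powr_0 cuts_tendsto_if_endographs_tendsto) auto
    qed
  qed
  then have lim: "AE \<alpha> in lebesgue_on {0..1}. (\<lambda>n. ?h n \<alpha>) \<longlonglongrightarrow> 0"
    by (subst AE_restrict_space_iff) auto
  \<comment> \<open>The sequence is shifted because the majorant is available from index \<open>1\<close> on.\<close>
  have "(\<lambda>n. \<integral>\<^sup>+ \<alpha>. ?h (Suc n) \<alpha> \<partial>lebesgue_on {0..1}) \<longlonglongrightarrow> 0"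
  proof (rule nn_integral_tendsto_0_dominated[where w = "\<lambda>\<alpha>. ennreal_powr (F \<alpha>) p"])
    show "(\<lambda>\<alpha>. ennreal_powr (F \<alpha>) p) \<in> borel_measurable (lebesgue_on {0..1})"
      using assms(4) by measurable
    show "AE \<alpha> in lebesgue_on {0..1}. ?h (Suc n) \<alpha> \<le> ennreal_powr (F \<alpha>) p" for n
      using assms(6) p by (intro AE_I2 ennreal_powr_mono) auto
    show "AE \<alpha> in lebesgue_on {0..1}. (\<lambda>n. ?h (Suc n) \<alpha>) \<longlonglongrightarrow> 0"
      using lim by eventually_elim (rule LIMSEQ_Suc)
  qed (rule assms(5))
  then have "(\<lambda>n. \<integral>\<^sup>+ \<alpha>. ?h n \<alpha> \<partial>lebesgue_on {0..1}) \<longlonglongrightarrow> 0"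
    by (rule LIMSEQ_imp_Suc)
  then show ?thesis
    unfolding d_p_def using p by (intro tendsto_ennreal_powr_0) auto
qed

end
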